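(* If a formula $\varphi$ of length $l$ is not $\mathrm{LC}^{\triangleright}$-valid, then there is a finite rooted $\mathrm{LC}^{\triangleright}$-model with at most $l+1$ worlds and a world of it at which $\varphi$ is not forced.
   Context: Formulae: $\varphi ::= p \mid \top \mid \bot \mid \varphi\land\varphi \mid \varphi\lor\varphi \mid \varphi\to\varphi \mid \varphi\Rightarrow\varphi \mid \triangleright\varphi$ with $p$ atomic; the length of a formula is its number of symbol occurrences. An $\mathrm{LC}^{\triangleright}$-frame is $\langle W,R\rangle$, $W$ nonempty, $R$ transitive, converse-well-founded (no infinite $x_1Rx_2R\cdots$) and connected ($x=y$ or $xRy$ or $yRx$). A model adds a valuation $\vartheta$ with persistence ($w\in\vartheta(p)$, $wRx$ imply $x\in\vartheta(p)$); it is rooted if some $w_0$ satisfies $w_0R^{=}v$ for all $v\in W$, where $R^{=}$ is the reflexive closure of $R$. Forcing: $M,w\Vdash p$ iff $w\in\vartheta(p)$; $\top,\bot,\land,\lor$ as usual; $M,w\Vdash\varphi\to\psi$ iff for all $x$ with $wR^{=}x$, $M,x\Vdash\varphi$ implies $M,x\Vdash\psi$; $M,w\Vdash\varphi\Rightarrow\psi$ iff the same for all $x$ with $wRx$; $M,w\Vdash\triangleright\varphi$ iff $M,x\Vdash\varphi$ for all $x$ with $wRx$. $\varphi$ is $\mathrm{LC}^{\triangleright}$-valid if forced at every world of every $\mathrm{LC}^{\triangleright}$-model. *)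

theory Defs
  imports Main
begin

datatype 'a fm =
    Atom 'a
  | Top
  | Bot
  | And "'a fm" "'a fm"
  | Or "'a fm" "'a fm"
  | Imp "'a fm" "'a fm"   \<comment> \<open>\<open>\<phi> \<rightarrow> \<psi>\<close>\<close>
  | SImp "'a fm" "'a fm"  \<comment> \<open>\<open>\<phi> \<Rightarrow> \<psi>\<close>\<close>
  | Later "'a fm"         \<comment> \<open>\<open>\<triangleright> \<phi>\<close>\<close>

text \<open>Parentheses are not counted as symbols.\<close>

primrec fm_length :: "'a fm \<Rightarrow> nat" where
  "fm_length (Atom p) = 1"
| "fm_length Top = 1"
| "fm_length Bot = 1"
| "fm_length (And \<phi> \<psi>) = fm_length \<phi> + fm_length \<psi> + 1"
| "fm_length (Or \<phi> \<psi>) = fm_length \<phi> + fm_length \<psi> + 1"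
| "fm_length (Imp \<phi> \<psi>) = fm_length \<phi> + fm_length \<psi> + 1"
| "fm_length (SImp \<phi> \<psi>) = fm_length \<phi> + fm_length \<psi> + 1"
| "fm_length (Later \<phi>) = fm_length \<phi> + 1"

record ('w, 'a) model =
  worlds :: "'w set"
  acc :: "'w rel"
  val :: "'a \<Rightarrow> 'w set"

definition converse_wf :: "'w rel \<Rightarrow> bool" where
  "converse_wf R \<longleftrightarrow> (\<nexists>x :: nat \<Rightarrow> 'w. \<forall>i. (x i, x (Suc i)) \<in> R)"

lemma converse_wf_iff_wf: "converse_wf R \<longleftrightarrow> wf (R\<inverse>)"
  by (simp add: converse_wf_def wf_iff_no_infinite_down_chain)

definition LC_frame :: "'w set \<Rightarrow> 'w rel \<Rightarrow> bool" where
  "LC_frame W R \<longleftrightarrow>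
     W \<noteq> {} \<and> R \<subseteq> W \<times> W \<and> trans R \<and> converse_wf R \<and> total_on W R"

definition LC_model :: "('w, 'a) model \<Rightarrow> bool" where
  "LC_model M \<longleftrightarrow>
     LC_frame (worlds M) (acc M) \<and>
     (\<forall>p. val M p \<subseteq> worlds M) \<and>
     (\<forall>p w x. w \<in> val M p \<and> (w, x) \<in> acc M \<longrightarrow> x \<in> val M p)"

definition rooted :: "('w, 'a) model \<Rightarrow> bool" where
  "rooted M \<longleftrightarrow> (\<exists>w\<^sub>0 \<in> worlds M. \<forall>v \<in> worlds M. (w\<^sub>0, v) \<in> (acc M)\<^sup>=)"

primrec forces :: "('w, 'a) model \<Rightarrow> 'w \<Rightarrow> 'a fm \<Rightarrow> bool" where
  "forces M w (Atom p) \<longleftrightarrow> w \<in> val M p"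
| "forces M w Top \<longleftrightarrow> True"
| "forces M w Bot \<longleftrightarrow> False"
| "forces M w (And \<phi> \<psi>) \<longleftrightarrow> forces M w \<phi> \<and> forces M w \<psi>"
| "forces M w (Or \<phi> \<psi>) \<longleftrightarrow> forces M w \<phi> \<or> forces M w \<psi>"
| "forces M w (Imp \<phi> \<psi>) \<longleftrightarrow>
     (\<forall>x \<in> worlds M. (w, x) \<in> (acc M)\<^sup>= \<longrightarrow> forces M x \<phi> \<longrightarrow> forces M x \<psi>)"
| "forces M w (SImp \<phi> \<psi>) \<longleftrightarrow>
     (\<forall>x \<in> worlds M. (w, x) \<in> acc M \<longrightarrow> forces M x \<phi> \<longrightarrow> forces M x \<psi>)"
| "forces M w (Later \<phi>) \<longleftrightarrow>
     (\<forall>x \<in> worlds M. (w, x) \<in> acc M \<longrightarrow> forces M x \<phi>)"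

text \<open>
  HOL cannot quantify over types inside a formula, so validity is indexed by the type of worlds.
  A theorem with hypothesis \<open>\<not> LC_valid TYPE('w) \<phi>\<close> for a type variable \<open>'w\<close> covers
  countermodels over every type, i.e. failure of validity in any model whatsoever.
\<close>

definition LC_valid :: "'w itself \<Rightarrow> 'a fm \<Rightarrow> bool" where
  "LC_valid _ \<phi> \<longleftrightarrow>
     (\<forall>M :: ('w, 'a) model. LC_model M \<longrightarrow> (\<forall>w \<in> worlds M. forces M w \<phi>))"

end

theory Submission
  imports Defs
begin

text \<open>
  Forcing is persistent, so by converse well-foundedness and connectedness the worlds refuting a
  given formula, if there are any, have an \<open>R\<^sup>=\<close>-greatest element. Restricting the countermodel to
  these last refuting worlds, one for each subformula, preserves forcing of all subformulas: if
  \<open>\<psi> \<rightarrow> \<chi>\<close> fails at \<open>w\<close> because \<open>x\<close> forces \<open>\<psi>\<close> but not \<open>\<chi>\<close>, then the last world refuting \<open>\<chi>\<close>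
  lies above \<open>x\<close>, hence still forces \<open>\<psi>\<close>.
\<close>

primrec subfms :: "'a fm \<Rightarrow> 'a fm set" where
  "subfms (Atom p) = {Atom p}"
| "subfms Top = {Top}"
| "subfms Bot = {Bot}"
| "subfms (And \<phi> \<psi>) = insert (And \<phi> \<psi>) (subfms \<phi> \<union> subfms \<psi>)"
| "subfms (Or \<phi> \<psi>) = insert (Or \<phi> \<psi>) (subfms \<phi> \<union> subfms \<psi>)"
| "subfms (Imp \<phi> \<psi>) = insert (Imp \<phi> \<psi>) (subfms \<phi> \<union> subfms \<psi>)"
| "subfms (SImp \<phi> \<psi>) = insert (SImp \<phi> \<psi>) (subfms \<phi> \<union> subfms \<psi>)"
| "subfms (Later \<phi>) = insert (Later \<phi>) (subfms \<phi>)"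

lemma self_in_subfms: "\<phi> \<in> subfms \<phi>"
  by (cases \<phi>) auto

lemma finite_subfms: "finite (subfms \<phi>)"
  by (induction \<phi>) auto

text \<open>One bound for all compound formulas: the binary connectives use it directly,
  \<open>Later\<close> uses it with \<open>B\<close> empty and \<open>n = 0\<close>.\<close>

lemma card_insert_Un_le:
  assumes "card A \<le> m" and "card B \<le> n"
  shows "card (insert x (A \<union> B)) \<le> Suc (m + n)"
  using assms card_insert_le_m1[of "Suc (m + n)" "A \<union> B" x] card_Un_le[of A B] by simp

lemma card_subfms_le: "card (subfms \<phi>) \<le> fm_length \<phi>"
proof (induction \<phi>)
  case (Later \<phi>)
  then show ?case using card_insert_Un_le[of "subfms \<phi>" _ "{}" 0] by simp
qed (auto intro: card_insert_Un_le)

lemma LC_model_trans: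
  "LC_model M \<Longrightarrow> (x, y) \<in> acc M \<Longrightarrow> (y, z) \<in> acc M \<Longrightarrow> (x, z) \<in> acc M"
  unfolding LC_model_def LC_frame_def by (meson transD)

text \<open>Atoms are covered by the condition on valuations. For the implications and
  \<open>Later\<close>, transitivity makes every world seen from \<open>x\<close> visible from
  \<open>w\<close>, so the clause at \<open>w\<close> already contains the clause at
  \<open>x\<close>.\<close>

lemma forces_persistent:
  assumes "LC_model M" and "(w, x) \<in> acc M" and "forces M w \<phi>"
  shows "forces M x \<phi>"
  using assms(3)
proof (induction \<phi>)
  case (Atom p)
  then show ?case using assms(1,2) by (auto simp: LC_model_def)
qed (use assms(2) LC_model_trans[OF assms(1)] in auto)

lemma forces_persistent_refl:
  "LC_model M \<Longrightarrow> (w, x) \<in> (acc M)\<^sup>= \<Longrightarrow> forces M w \<phi> \<Longrightarrow> forces M x \<phi>"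
  using forces_persistent by auto

text \<open>Asking for a greatest refuting world, not just a maximal one, provides an edge or an
  equality from any refuting world to \<open>m\<close>; this is what lets \<open>m\<close> replace
  an arbitrary witness.\<close>

definition last_refuting :: "('w, 'a) model \<Rightarrow> 'a fm \<Rightarrow> 'w \<Rightarrow> bool" where
  "last_refuting M \<phi> m \<longleftrightarrow> m \<in> worlds M \<and> \<not> forces M m \<phi> \<and>
     (\<forall>x \<in> worlds M. \<not> forces M x \<phi> \<longrightarrow> (x, m) \<in> (acc M)\<^sup>=)"

lemma ex_last_refuting:
  assumes "LC_model M" and "x \<in> worlds M" and "\<not> forces M x \<phi>"
  shows "\<exists>m. last_refuting M \<phi> m"
proof -
  let ?Q = "{x \<in> worlds M. \<not> forces M x \<phi>}"
  have wf: "wf ((acc M)\<inverse>)" and tot: "total_on (worlds M) (acc M)"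
    using assms(1) by (auto simp: LC_model_def LC_frame_def converse_wf_iff_wf)
  obtain m where m: "m \<in> ?Q" "\<And>y. (m, y) \<in> acc M \<Longrightarrow> y \<notin> ?Q"
    using wfE_min[OF wf, of x ?Q] assms by auto
  \<comment> \<open>\<open>m\<close> is maximal in \<open>?Q\<close>. Connectedness makes it
    greatest, because the alternative \<open>(m, y)\<close> is excluded.\<close>
  then have "(y, m) \<in> (acc M)\<^sup>=" if "y \<in> ?Q" for y
    using tot that by (auto simp: total_on_def)
  then show ?thesis using m(1) by (auto simp: last_refuting_def)
qed

definition pullback :: "('v \<Rightarrow> 'w) \<Rightarrow> 'v set \<Rightarrow> ('w, 'a) model \<Rightarrow> ('v, 'a) model" where
  "pullback f V M = \<lparr>worlds = V,
     acc = {(i, j). i \<in> V \<and> j \<in> V \<and> (f i, f j) \<in> acc M},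
     val = \<lambda>p. {i \<in> V. f i \<in> val M p}\<rparr>"

lemma pullback_simps [simp]:
  "worlds (pullback f V M) = V"
  "(i, j) \<in> acc (pullback f V M) \<longleftrightarrow> i \<in> V \<and> j \<in> V \<and> (f i, f j) \<in> acc M"
  "i \<in> val (pullback f V M) p \<longleftrightarrow> i \<in> V \<and> f i \<in> val M p"
  by (auto simp: pullback_def)

text \<open>\<open>f\<close> sends an infinite chain to an infinite chain of \<open>M\<close>.
  Injectivity gives connectedness: distinct indices name distinct worlds, which are comparable in
  \<open>M\<close>.\<close>

lemma LC_model_pullback:
  assumes M: "LC_model M" and V: "V \<noteq> {}" "f ` V \<subseteq> worlds M" "inj_on f V"
  shows "LC_model (pullback f V M)"
proof -
  have "trans (acc (pullback f V M))"
    using LC_model_trans[OF M] by (auto intro!: transI)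
  moreover have "converse_wf (acc (pullback f V M))"
    unfolding converse_wf_def
  proof
    assume "\<exists>x. \<forall>i. (x i, x (Suc i)) \<in> acc (pullback f V M)"
    then obtain x where "\<forall>i. (f (x i), f (x (Suc i))) \<in> acc M"
      by auto
    moreover have "converse_wf (acc M)"
      using M by (simp add: LC_model_def LC_frame_def)
    ultimately show False
      unfolding converse_wf_def by fast
  qed
  moreover have "total_on V (acc (pullback f V M))"
  proof -
    have "total_on (worlds M) (acc M)"
      using M by (simp add: LC_model_def LC_frame_def)
    then show ?thesis
      using V(2,3) unfolding total_on_def inj_on_def image_subset_iff pullback_simps by metis
  qed
  moreover have "acc (pullback f V M) \<subseteq> V \<times> V" by auto
  moreover have "\<forall>p w x. w \<in> val (pullback f V M) p \<and> (w, x) \<in> acc (pullback f V M)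
      \<longrightarrow> x \<in> val (pullback f V M) p"
    using M by (auto simp: LC_model_def)
  ultimately show ?thesis
    using V(1) by (auto simp: LC_model_def LC_frame_def)
qed

text \<open>Passing from \<open>M\<close> to the pullback only removes worlds to be checked.
  Conversely, a failure at some \<open>x\<close> of \<open>M\<close> is moved up to the last world
  refuting the formula that fails at \<open>x\<close>, and this world has a name in
  \<open>V\<close>.\<close>

lemma forces_pullback:
  assumes M: "LC_model M" and V: "f ` V \<subseteq> worlds M" "inj_on f V"
    and last: "\<And>\<psi> x. \<psi> \<in> subfms \<phi> \<Longrightarrow> x \<in> worlds M \<Longrightarrow> \<not> forces M x \<psi>
      \<Longrightarrow> \<exists>j \<in> V. last_refuting M \<psi> (f j)"
    and "i \<in> V"
  shows "forces (pullback f V M) i \<phi> \<longleftrightarrow> forces M (f i) \<phi>"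
  using last \<open>i \<in> V\<close>
proof (induction \<phi> arbitrary: i)
  case (Imp \<phi> \<psi>)
  have IH: "forces (pullback f V M) j \<phi> \<longleftrightarrow> forces M (f j) \<phi>"
    "forces (pullback f V M) j \<psi> \<longleftrightarrow> forces M (f j) \<psi>" if "j \<in> V" for j
    using Imp that by simp_all
  \<comment> \<open>By injectivity, the reflexive parts of the two relations agree as well.\<close>
  have eq: "(i, j) \<in> (acc (pullback f V M))\<^sup>= \<longleftrightarrow> (f i, f j) \<in> (acc M)\<^sup>=" if "j \<in> V" for j
    using Imp.prems(2) that V(2) by (auto simp: inj_on_def)
  show ?case
  proof
    assume L: "forces (pullback f V M) i (Imp \<phi> \<psi>)"
    show "forces M (f i) (Imp \<phi> \<psi>)"
    proof (rule ccontr)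
      assume "\<not> forces M (f i) (Imp \<phi> \<psi>)"
      then obtain x where x: "x \<in> worlds M" "(f i, x) \<in> (acc M)\<^sup>=" "forces M x \<phi>" "\<not> forces M x \<psi>"
        by auto
      then obtain j where j: "j \<in> V" "last_refuting M \<psi> (f j)"
        using Imp.prems(1)[of \<psi> x] self_in_subfms[of \<psi>] by auto
      have xj: "(x, f j) \<in> (acc M)\<^sup>=" and "\<not> forces M (f j) \<psi>"
        using j(2) x by (auto simp: last_refuting_def)
      moreover have "(f i, f j) \<in> (acc M)\<^sup>="
        using x(2) xj LC_model_trans[OF M] by blast
      moreover have "forces M (f j) \<phi>"
        using forces_persistent_refl[OF M xj x(3)] .
      ultimately show False
        using L IH[OF j(1)] eq[OF j(1)] j(1) by auto
    qed
  next
    assume R: "forces M (f i) (Imp \<phi> \<psi>)"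
    have "forces (pullback f V M) j \<psi>"
      if "j \<in> V" "(i, j) \<in> (acc (pullback f V M))\<^sup>=" "forces (pullback f V M) j \<phi>" for j
    proof -
      have "f j \<in> worlds M" using that V(1) by auto
      then show ?thesis using R that IH[of j] eq[of j] by auto
    qed
    then show "forces (pullback f V M) i (Imp \<phi> \<psi>)" by auto
  qed
next
  case (SImp \<phi> \<psi>)
  have IH: "forces (pullback f V M) j \<phi> \<longleftrightarrow> forces M (f j) \<phi>"
    "forces (pullback f V M) j \<psi> \<longleftrightarrow> forces M (f j) \<psi>" if "j \<in> V" for j
    using SImp that by simp_all
  show ?case
  proof
    assume L: "forces (pullback f V M) i (SImp \<phi> \<psi>)"
    show "forces M (f i) (SImp \<phi> \<psi>)"
    proof (rule ccontr)
      assume "\<not> forces M (f i) (SImp \<phi> \<psi>)"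
      then obtain x where x: "x \<in> worlds M" "(f i, x) \<in> acc M" "forces M x \<phi>" "\<not> forces M x \<psi>"
        by auto
      then obtain j where j: "j \<in> V" "last_refuting M \<psi> (f j)"
        using SImp.prems(1)[of \<psi> x] self_in_subfms[of \<psi>] by auto
      have xj: "(x, f j) \<in> (acc M)\<^sup>=" and "\<not> forces M (f j) \<psi>"
        using j(2) x by (auto simp: last_refuting_def)
      \<comment> \<open>A strict step to \<open>x\<close> followed by a strict step or an equality
        is still strict.\<close>
      moreover have "(f i, f j) \<in> acc M"
        using x(2) xj LC_model_trans[OF M] by blast
      moreover have "forces M (f j) \<phi>"
        using forces_persistent_refl[OF M xj x(3)] .
      ultimately show False
        using L IH[OF j(1)] j(1) SImp.prems(2) by auto
    qed
  qed (use IH V(1) in auto)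
next
  case (Later \<phi>)
  have IH: "forces (pullback f V M) j \<phi> \<longleftrightarrow> forces M (f j) \<phi>" if "j \<in> V" for j
    using Later that by simp
  show ?case
  proof
    assume L: "forces (pullback f V M) i (Later \<phi>)"
    show "forces M (f i) (Later \<phi>)"
    proof (rule ccontr)
      assume "\<not> forces M (f i) (Later \<phi>)"
      then obtain x where x: "x \<in> worlds M" "(f i, x) \<in> acc M" "\<not> forces M x \<phi>"
        by auto
      then obtain j where j: "j \<in> V" "last_refuting M \<phi> (f j)"
        using Later.prems(1)[of \<phi> x] self_in_subfms[of \<phi>] by auto
      have "(x, f j) \<in> (acc M)\<^sup>=" and "\<not> forces M (f j) \<phi>"
        using j(2) x by (auto simp: last_refuting_def)
      moreover from this have "(f i, f j) \<in> acc M"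
        using x(2) LC_model_trans[OF M] by blast
      ultimately show False
        using L IH[OF j(1)] j(1) Later.prems(2) by auto
    qed
  qed (use IH V(1) in auto)
qed auto

text \<open>On finitely many worlds, acyclicity makes \<open>acc M\<close> itself well-founded, so
  there is a minimal world; connectedness turns it into a root.\<close>

lemma finite_LC_model_rooted:
  assumes M: "LC_model M" and fin: "finite (worlds M)"
  shows "rooted M"
proof -
  have R: "acc M \<subseteq> worlds M \<times> worlds M" and ne: "worlds M \<noteq> {}"
    and tot: "total_on (worlds M) (acc M)" and wf: "wf ((acc M)\<inverse>)"
    using M by (auto simp: LC_model_def LC_frame_def converse_wf_iff_wf)
  have "finite (acc M)"
    using R fin by (meson finite_SigmaI finite_subset)
  moreover have "acyclic (acc M)"
    using wf_acyclic[OF wf] by simp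
  ultimately have "wf (acc M)"
    by (rule finite_acyclic_wf)
  with ne obtain m where "m \<in> worlds M" "\<And>y. (y, m) \<in> acc M \<Longrightarrow> y \<notin> worlds M"
    using wfE_min[of "acc M" _ "worlds M"] by blast
  then show ?thesis
    using tot unfolding rooted_def total_on_def by blast
qed

theorem theorem5:
  fixes \<phi> :: "'a fm" and l :: nat
  assumes "fm_length \<phi> = l"
    and "\<not> LC_valid TYPE('w) \<phi>"
  shows "\<exists>M :: (nat, 'a) model.
           LC_model M \<and> rooted M \<and> finite (worlds M) \<and> card (worlds M) \<le> l + 1 \<and>
           (\<exists>w \<in> worlds M. \<not> forces M w \<phi>)"
proof -
  obtain M :: "('w, 'a) model" and w where M: "LC_model M" and w: "w \<in> worlds M" "\<not> forces M w \<phi>"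
    using assms(2) by (auto simp: LC_valid_def)
  \<comment> \<open>Only subformulas refuted somewhere have a last refuting world, so the choice
    \<open>g\<close> is meaningful on \<open>F\<close> alone.\<close>
  define F where "F = {\<psi> \<in> subfms \<phi>. \<exists>x \<in> worlds M. \<not> forces M x \<psi>}"
  define g where "g \<psi> = (SOME m. last_refuting M \<psi> m)" for \<psi>
  have g: "last_refuting M \<psi> (g \<psi>)" if "\<psi> \<in> F" for \<psi>
    using that ex_last_refuting[OF M] unfolding g_def F_def by (auto intro: someI_ex)
  have "finite F"
    using finite_subfms[of \<phi>] by (simp add: F_def)
  have "card (g ` F) \<le> card F"
    using \<open>finite F\<close> by (rule card_image_le)
  also have "\<dots> \<le> card (subfms \<phi>)"
    by (rule card_mono) (auto simp: F_def finite_subfms)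
  also have "\<dots> \<le> l"
    using card_subfms_le[of \<phi>] assms(1) by simp
  finally have card: "card (g ` F) \<le> l" .
  obtain e where e: "bij_betw e {0..<card (g ` F)} (g ` F)"
    using ex_bij_betw_nat_finite \<open>finite F\<close> by blast
  define V where "V = {0..<card (g ` F)}"
  have im: "e ` V = g ` F" and inj: "inj_on e V"
    using e by (auto simp: V_def bij_betw_def)
  have sub: "e ` V \<subseteq> worlds M"
    using im g by (auto simp: last_refuting_def)
  have last: "\<exists>j \<in> V. last_refuting M \<psi> (e j)"
    if "\<psi> \<in> subfms \<phi>" "x \<in> worlds M" "\<not> forces M x \<psi>" for \<psi> x
  proof -
    have "\<psi> \<in> F" using that by (auto simp: F_def)
    then have "g \<psi> \<in> e ` V" using im by blast
    then obtain j where "j \<in> V" "g \<psi> = e j" by blast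
    with g[OF \<open>\<psi> \<in> F\<close>] show ?thesis by auto
  qed
  \<comment> \<open>This \<open>j\<close> shows that \<open>V\<close> is nonempty and is also the
    world refuting \<phi>. As it is already counted for \<phi> itself, \<open>w\<close> need not be
    added and at most \<open>l\<close> worlds result.\<close>
  obtain j where j: "j \<in> V" "last_refuting M \<phi> (e j)"
    using last[OF self_in_subfms w] by blast
  have N: "LC_model (pullback e V M)"
    using LC_model_pullback[OF M _ sub inj] j(1) by blast
  moreover have "finite V" "card V \<le> l + 1"
    using card by (simp_all add: V_def)
  moreover have "\<not> forces (pullback e V M) j \<phi>"
    using forces_pullback[OF M sub inj last j(1)] j(2) by (simp add: last_refuting_def)
  ultimately show ?thesis
    using finite_LC_model_rooted[OF N] j(1) by (intro exI[of _ "pullback e V M"]) auto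
qed

end
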